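(* Let $(g_h^n)_{n\ge0}\subset V^h$ satisfy the $Q^k$ finite element scheme $$(\mathcal M g_h^{n+1},\phi_h)+\Delta t\,(D\mathcal M\nabla g_h^{n+1},\nabla\phi_h)+\Delta t\,(\vec u\,g_h^{n+1},\nabla\phi_h)=(\mathcal M g_h^n,\phi_h)\qquad\forall\phi_h\in V^h,$$ and set $\rho_h^n=\mathcal M g_h^n$. Then for any $n\ge0$ the total mass is conserved: $$\int_\Omega\rho_h^n=\int_\Omega\rho_h^0 .$$
   Context: $\Omega\subset\mathbb R^d$ ($d=1$ or $2$) is a bounded rectangular domain with outward unit normal $\vec n$; $D>0$ is a constant; $\Delta t>0$; $\mathcal M\in C^1(\bar\Omega)$ is a given function with $\mathcal M\ge\epsilon_0>0$ and $\int_\Omega\mathcal M=1$ (the invariant measure); $\vec u$ is a given time-independent continuously differentiable vector field with $\nabla\cdot\vec u=0$ in $\Omega$ and $\vec u\cdot\vec n=0$ on $\partial\Omega$. $\mathcal E_h$ is a uniform rectangular partition of $\Omega$; for an integer $k\ge1$, $V^h=\{v_h\in C(\Omega): v_h|_E\in\mathbb Q^k(E)\ \forall E\in\mathcal E_h\}\subset H^1(\Omega)$, where $\mathbb Q^k(E)$ is the space of polynomials on $E$ of degree at most $k$ in each variable. $(\cdot,\cdot)$ is the $L^2(\Omega)$ inner product. *)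

theory Defs
  imports "HOL-Analysis.Analysis"
begin

text \<open>
  The ambient space is an arbitrary \<open>'a :: euclidean_space\<close> with its standard basis \<open>Basis\<close> as
  coordinate directions; the rectangular domain is the open box \<open>box a b\<close>.  Functions on the
  domain are total functions whose values outside the closed box are irrelevant.
\<close>

definition C1_on :: "'a::euclidean_space set \<Rightarrow> ('a \<Rightarrow> 'b::euclidean_space) \<Rightarrow> bool" where
  "C1_on S f \<longleftrightarrow> (\<exists>f' :: 'a \<Rightarrow> 'a \<Rightarrow>\<^sub>L 'b. continuous_on S f' \<and>
     (\<forall>x\<in>S. (f has_derivative blinfun_apply (f' x)) (at x)))"

text \<open>\<open>C\<^sup>1\<close> up to the boundary of an open set \<open>S\<close>: the function and its derivative on \<open>S\<close>
  extend continuously to the closure.\<close>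

definition C1_closure :: "'a::euclidean_space set \<Rightarrow> ('a \<Rightarrow> 'b::euclidean_space) \<Rightarrow> bool" where
  "C1_closure S f \<longleftrightarrow> continuous_on (closure S) f \<and>
     (\<exists>f' :: 'a \<Rightarrow> 'a \<Rightarrow>\<^sub>L 'b. continuous_on (closure S) f' \<and>
       (\<forall>x\<in>S. (f has_derivative blinfun_apply (f' x)) (at x)))"

text \<open>For a continuous piecewise polynomial \<open>f\<close>, \<open>grad f\<close> is the elementwise gradient, which
  represents the \<open>H\<^sup>1\<close> gradient.  On the element faces, a Lebesgue null set, the value is
  unspecified wherever \<open>f\<close> is not differentiable.\<close>

definition grad :: "('a::euclidean_space \<Rightarrow> real) \<Rightarrow> 'a \<Rightarrow> 'a" where
  "grad f x = (\<Sum>i\<in>Basis. frechet_derivative f (at x) i *\<^sub>R i)"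

definition divergence :: "('a::euclidean_space \<Rightarrow> 'a) \<Rightarrow> 'a \<Rightarrow> real" where
  "divergence u x = (\<Sum>i\<in>Basis. frechet_derivative u (at x) i \<bullet> i)"

text \<open>The outward unit normals of \<open>box a b\<close> at a boundary point \<open>x\<close>: exactly one inside a face.
  At a corner (\<open>d = 2\<close>), where the normal is undefined, these are the normals of both adjacent
  faces; for a field continuous up to the boundary, vanishing normal component there is implied
  by the condition inside the faces.\<close>

definition outward_normals :: "'a::euclidean_space \<Rightarrow> 'a \<Rightarrow> 'a \<Rightarrow> 'a set" where
  "outward_normals a b x =
     {- i | i. i \<in> Basis \<and> x \<bullet> i = a \<bullet> i} \<union> {i. i \<in> Basis \<and> x \<bullet> i = b \<bullet> i}"

text \<open>One definition serves scalar and vector functions, since \<open>\<bullet>\<close> is multiplication on \<open>real\<close>.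
  The completed measure makes the integral insensitive to values on null sets.\<close>

definition L2_inner ::
    "'a::euclidean_space set \<Rightarrow> ('a \<Rightarrow> 'b::real_inner) \<Rightarrow> ('a \<Rightarrow> 'b) \<Rightarrow> real" where
  "L2_inner S f g = (LINT x:S|lebesgue. f x \<bullet> g x)"

text \<open>The uniform rectangular partition of \<open>box a b\<close> into \<open>N i\<close> equal intervals in each
  coordinate direction \<open>i\<close>, consisting of closed cells.\<close>

definition uniform_partition ::
    "'a::euclidean_space \<Rightarrow> 'a \<Rightarrow> ('a \<Rightarrow> nat) \<Rightarrow> 'a set set" where
  "uniform_partition a b N =
     (let node = (\<lambda>j :: 'a \<Rightarrow> nat.
            \<Sum>i\<in>Basis. (a \<bullet> i + real (j i) * ((b \<bullet> i - a \<bullet> i) / real (N i))) *\<^sub>R i)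
      in {cbox (node j) (node (\<lambda>i. Suc (j i))) | j. \<forall>i\<in>Basis. j i < N i})"

definition Qk :: "nat \<Rightarrow> ('a::euclidean_space \<Rightarrow> real) set" where
  "Qk k = {p. \<exists>c :: ('a \<Rightarrow> nat) \<Rightarrow> real.
     p = (\<lambda>x. \<Sum>\<alpha>\<in>(\<Pi>\<^sub>E i\<in>Basis. {..k}). c \<alpha> * (\<Prod>i\<in>Basis. (x \<bullet> i) ^ \<alpha> i))}"

definition Vh ::
    "'a::euclidean_space set \<Rightarrow> 'a set set \<Rightarrow> nat \<Rightarrow> ('a \<Rightarrow> real) set" where
  "Vh \<Omega> \<E> k = {v. continuous_on (closure \<Omega>) v \<and> (\<forall>E\<in>\<E>. \<exists>p\<in>Qk k. \<forall>x\<in>E. v x = p x)}"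

end

theory Submission
  imports Defs
begin

text \<open>The constant 1 is an admissible test function: constants are continuous and lie in Q^k
  on every cell (\<open>const_in_Qk\<close>, \<open>const_in_Vh\<close>). Its gradient vanishes, so
  the diffusion and the convection term both drop out of the scheme, leaving (M g^{n+1}, 1) = (M
  g^n, 1). This is conservation of mass over one time step; induction on n does the rest.\<close>

lemma const_in_Qk: "(\<lambda>x::'a::euclidean_space. r) \<in> Qk k"
proof -
  \<comment> \<open>\<open>?z\<close> is the zero multi-index. It is restricted to
    \<open>Basis\<close> because members of \<open>?A\<close> must be \<open>undefined\<close>
    elsewhere.\<close>
  let ?A = "(\<Pi>\<^sub>E i\<in>(Basis::'a set). {..k})" and ?z = "\<lambda>i\<in>(Basis::'a set). 0::nat"
  have fin: "finite ?A"
    by (simp add: finite_PiE)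
  have mem: "?z \<in> ?A"
    by auto
  have "(\<Sum>\<alpha>\<in>?A. (if \<alpha> = ?z then r else 0) * (\<Prod>i\<in>Basis. (x \<bullet> i) ^ \<alpha> i)) = r" for x :: 'a
  proof -
    \<comment> \<open>Only the monomial of \<open>?z\<close> survives; it equals 1 even where a
      coordinate vanishes, since 0 ^ 0 = 1.\<close>
    have "(\<Sum>\<alpha>\<in>?A. (if \<alpha> = ?z then r else 0) * (\<Prod>i\<in>Basis. (x \<bullet> i) ^ \<alpha> i))
        = (\<Sum>\<alpha>\<in>?A. if \<alpha> = ?z then r * (\<Prod>i\<in>Basis. (x \<bullet> i) ^ ?z i) else 0)"
      by (rule sum.cong) auto
    then show ?thesis
      using fin mem by (simp add: sum.delta)
  qed
  then show ?thesis
    unfolding Qk_def by (intro CollectI exI[of _ "\<lambda>\<alpha>. if \<alpha> = ?z then r else 0"] ext) simp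
qed

lemma const_in_Vh: "(\<lambda>x. r) \<in> Vh \<Omega> \<E> k"
  unfolding Vh_def using const_in_Qk by fastforce

text \<open>A constant is differentiable everywhere, cell faces included, so this is an equality of
  functions and can rewrite \<open>grad \<phi>\<close> inside \<open>L2_inner\<close>.\<close>

lemma grad_const [simp]: "grad (\<lambda>x. r) = (\<lambda>x. 0)"
  by (simp add: grad_def fun_eq_iff)

lemma L2_inner_zero_right [simp]: "L2_inner S f (\<lambda>x. 0) = 0"
  by (simp add: L2_inner_def)

lemma L2_inner_one_right: "L2_inner S f (\<lambda>x. 1) = (LINT x:S|lebesgue. f x)"
  by (simp add: L2_inner_def)

theorem proposition2p2:
  fixes a b :: "'a::euclidean_space"
    and \<Omega> :: "'a set"
    and N :: "'a \<Rightarrow> nat"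
    and \<E> :: "'a set set"
    and k :: nat
    and D \<Delta>t \<epsilon>\<^sub>0 :: real
    and M :: "'a \<Rightarrow> real"
    and u :: "'a \<Rightarrow> 'a"
    and g \<rho> :: "nat \<Rightarrow> 'a \<Rightarrow> real"
  assumes "DIM('a) = 1 \<or> DIM('a) = 2"
    and "\<forall>i\<in>Basis. a \<bullet> i < b \<bullet> i"
    and "\<Omega> = box a b"
    and "D > 0"
    and "\<Delta>t > 0"
    and "C1_closure \<Omega> M"
    and "\<epsilon>\<^sub>0 > 0"
    and "\<forall>x\<in>closure \<Omega>. M x \<ge> \<epsilon>\<^sub>0"
    and "(LINT x:\<Omega>|lebesgue. M x) = 1"
    and "C1_on \<Omega> u"
    and "continuous_on (closure \<Omega>) u"
    and "\<forall>x\<in>\<Omega>. divergence u x = 0"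
    and "\<forall>x\<in>frontier \<Omega>. \<forall>\<nu>\<in>outward_normals a b x. u x \<bullet> \<nu> = 0"
    and "\<forall>i\<in>Basis. N i \<ge> 1"
    and "\<E> = uniform_partition a b N"
    and "k \<ge> 1"
    and "\<forall>n. g n \<in> Vh \<Omega> \<E> k"
    and "\<forall>n. \<forall>\<phi>\<in>Vh \<Omega> \<E> k.
           L2_inner \<Omega> (\<lambda>x. M x * g (Suc n) x) \<phi>
           + \<Delta>t * L2_inner \<Omega> (\<lambda>x. (D * M x) *\<^sub>R grad (g (Suc n)) x) (grad \<phi>)
           + \<Delta>t * L2_inner \<Omega> (\<lambda>x. g (Suc n) x *\<^sub>R u x) (grad \<phi>)
           = L2_inner \<Omega> (\<lambda>x. M x * g n x) \<phi>"
    and "\<forall>n x. \<rho> n x = M x * g n x"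
  shows "\<forall>n. (LINT x:\<Omega>|lebesgue. \<rho> n x) = (LINT x:\<Omega>|lebesgue. \<rho> 0 x)"
proof
  fix n
  note in_space = const_in_Vh[of 1 \<Omega> \<E> k]
  have step: "(LINT x:\<Omega>|lebesgue. \<rho> (Suc m) x) = (LINT x:\<Omega>|lebesgue. \<rho> m x)" for m
    \<comment> \<open>The scheme tested with \<phi> = 1; \<open>assms(19)\<close> identifies
      \<open>M x * g m x\<close> with \<open>\<rho> m x\<close>.\<close>
    using assms(18)[rule_format, OF in_space, of m] assms(19)
    by (simp add: L2_inner_one_right)
  show "(LINT x:\<Omega>|lebesgue. \<rho> n x) = (LINT x:\<Omega>|lebesgue. \<rho> 0 x)"
    by (induction n) (simp_all only: step)
qed

end
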